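(* If $\mathrm{cov}(\mathcal{M})>\omega_1$, then every first countable and separable cellular-compact $T_2$ space is compact.
   Context: $T_2$ means Hausdorff. $\mathrm{cov}(\mathcal{M})$ is the least number of meager subsets of the real line whose union is the whole real line. For an infinite cardinal $\mu$, the statement $\mathrm{cov}(\mathcal{M})>\mu$ is equivalent to $MA_{\mu}(\text{countable})$: for every countable partial order and every family of at most $\mu$ dense subsets of it there is a filter meeting all of them. A cellular family in a topological space is a family of pairwise disjoint non-empty open sets. A space $X$ is cellular-compact if for every cellular family $\mathcal{U}$ of open subsets of $X$ there is a compact subspace $K\subset X$ such that $K\cap U\neq\emptyset$ for each $U\in\mathcal{U}$. *)

theory Defs
  imports "HOL-Analysis.Analysis"
begin

unbundle cardinal_syntax

definition nowhere_dense :: "'a::topological_space set \<Rightarrow> bool" where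
  "nowhere_dense N \<longleftrightarrow> interior (closure N) = {}"

definition meager :: "'a::topological_space set \<Rightarrow> bool" where
  "meager A \<longleftrightarrow> (\<exists>\<N>. countable \<N> \<and> (\<forall>N\<in>\<N>. nowhere_dense N) \<and> A = \<Union>\<N>)"

definition meager_cover_of_reals :: "real set set \<Rightarrow> bool" where
  "meager_cover_of_reals \<F> \<longleftrightarrow> (\<forall>A\<in>\<F>. meager A) \<and> \<Union>\<F> = UNIV"

text \<open>
  The covering number of the meager ideal, a cardinal in the sense of
  \<^theory>\<open>HOL.BNF_Cardinal_Order_Relation\<close>: the least cardinality of a family of meager sets
  whose union is the real line. The choice is determined up to cardinal isomorphism, and the
  two lemmas below show that the minimum is attained.
\<close>
definition cov_meager :: "real set rel" where
  "cov_meager = (SOME r. \<exists>\<F>. meager_cover_of_reals \<F> \<and> r = |\<F>| \<and>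
      (\<forall>\<G>. meager_cover_of_reals \<G> \<longrightarrow> |\<F>| \<le>o |\<G>| ))"

lemma cov_meager_attained:
  "\<exists>\<F>. meager_cover_of_reals \<F> \<and> cov_meager = |\<F>| \<and>
      (\<forall>\<G>. meager_cover_of_reals \<G> \<longrightarrow> |\<F>| \<le>o |\<G>| )"
proof -
  have "meager {x}" for x :: real
    unfolding meager_def nowhere_dense_def by (rule exI[of _ "{{x}}"]) simp
  then have "meager_cover_of_reals (range (\<lambda>x. {x}))"
    unfolding meager_cover_of_reals_def by auto
  then have "card_of ` {\<F>. meager_cover_of_reals \<F>} \<noteq> {}"
    by blast
  then have "\<exists>r\<in>card_of ` {\<F>. meager_cover_of_reals \<F>}.
      \<forall>r'\<in>card_of ` {\<F>. meager_cover_of_reals \<F>}. r \<le>o r'"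
    by (rule exists_minim_Card_order) (auto simp: card_of_Card_order)
  then have "\<exists>r \<F>. meager_cover_of_reals \<F> \<and> r = |\<F>| \<and>
      (\<forall>\<G>. meager_cover_of_reals \<G> \<longrightarrow> |\<F>| \<le>o |\<G>| )"
    by blast
  then show ?thesis
    unfolding cov_meager_def by (rule someI_ex)
qed

lemma cov_meager_le: "meager_cover_of_reals \<G> \<Longrightarrow> cov_meager \<le>o |\<G>|"
  using cov_meager_attained by auto

definition cellular_family :: "'a topology \<Rightarrow> 'a set set \<Rightarrow> bool" where
  "cellular_family X \<U> \<longleftrightarrow> (\<forall>U\<in>\<U>. openin X U \<and> U \<noteq> {}) \<and> pairwise disjnt \<U>"

definition cellular_compact :: "'a topology \<Rightarrow> bool" where
  "cellular_compact X \<longleftrightarrow>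
     (\<forall>\<U>. cellular_family X \<U> \<longrightarrow> (\<exists>K. compactin X K \<and> (\<forall>U\<in>\<U>. K \<inter> U \<noteq> {})))"

end

theory Submission
  imports Defs "HOL-Library.Countable_Set_Type"
begin

text \<open>
  The proof shows that all closed nowhere dense subsets of \<^term>\<open>X\<close> are compact and deduces the
  compactness of \<^term>\<open>X\<close> itself.

  That this suffices uses cellular-compactness only
  (\<open>cellular_compact_imp_compact_if_nowhere_dense_compact\<close>). Given an open cover, the union of a
  maximal cellular family refining it is dense, so the complement of that union is nowhere dense
  and is covered by finitely many members of the cover, with union \<open>U\<close> say. All but finitely many
  cells lie inside the closure of \<open>U\<close>: the non-empty parts of cells outside that closure
  all meet one compact set, and finitely many cells cover what this set has outside \<open>U\<close>. What is left is the
  frontier of \<open>U\<close>, which is again nowhere dense.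

  Let \<open>Y\<close> be closed and nowhere dense. Every subset \<open>S\<close> of \<open>Y\<close> with at most \<open>\<omega>\<^sub>1\<close> points lies in
  a compact set (\<open>small_subset_of_nowhere_dense_in_compact\<close>), and this is where the covering
  number enters. Finite cellular families of members of a countable \<open>\<pi>\<close>-base whose closures miss
  \<open>Y\<close> form a countable partial order. Given a condition \<open>p\<close> and a neighbourhood of a point of
  \<open>S\<close>, some cell inside the neighbourhood can be added to \<open>p\<close>, since the closure of \<open>\<Union>p\<close> misses
  the point and \<open>Y\<close> has empty interior. Martin's axiom for countable orders (\<open>MA_countable\<close>) meets
  all these \<open>\<omega>\<^sub>1\<close> dense sets at once; a compact set meeting every cell of the resulting cellular
  family comes arbitrarily close to each point of \<open>S\<close>, so it contains \<open>S\<close>. Keeping the closure of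
  a new cell away from \<open>Y\<close> requires regularity, which is itself a consequence of the hypotheses
  (\<open>first_countable_cellular_compact_imp_regular\<close>).

  Finally, a closed set \<open>Y\<close> whose subsets of size at most \<open>\<omega>\<^sub>1\<close> lie in compact sets is compact
  (\<open>compactin_if_omega1_subsets_in_compact\<close>): a bad open cover would produce a free sequence of
  length \<open>\<omega>\<^sub>1\<close> in \<open>Y\<close>, and first countability prevents the range of such a sequence from having
  a compact closure.
\<close>

section \<open>Regularity of first countable cellular-compact Hausdorff spaces\<close>

lemma local_base_sequence:
  assumes "first_countable X" "x \<in> topspace X"
  obtains B :: "nat \<Rightarrow> 'a set"
  where "\<And>n. openin X (B n)" "\<And>n. x \<in> B n"
    "\<And>U. openin X U \<Longrightarrow> x \<in> U \<Longrightarrow> \<exists>n. B n \<subseteq> U"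
proof -
  obtain \<B> where \<B>: "countable \<B>" "\<And>V. V \<in> \<B> \<Longrightarrow> openin X V"
    "\<And>U. openin X U \<Longrightarrow> x \<in> U \<Longrightarrow> \<exists>V\<in>\<B>. x \<in> V \<and> V \<subseteq> U"
    using assms unfolding first_countable_def by metis
  define \<C> where "\<C> = {V \<in> \<B>. x \<in> V}"
  have ne: "\<C> \<noteq> {}" and cnt: "countable \<C>"
    using \<B>(1) \<B>(3)[OF openin_topspace assms(2)] by (auto simp: \<C>_def)
  show thesis
  proof (rule that[of "from_nat_into \<C>"])
    show "openin X (from_nat_into \<C> n)" "x \<in> from_nat_into \<C> n" for n
      using from_nat_into[OF ne, of n] \<B>(2) by (auto simp: \<C>_def)
    show "\<exists>n. from_nat_into \<C> n \<subseteq> U" if "openin X U" "x \<in> U" for U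
      using \<B>(3)[OF that] from_nat_into_surj[OF cnt] unfolding \<C>_def by blast
  qed
qed

lemma closedin_memI:
  assumes "closedin X K" "x \<in> topspace X"
    and "\<And>U. openin X U \<Longrightarrow> x \<in> U \<Longrightarrow> K \<inter> U \<noteq> {}"
  shows "x \<in> K"
proof -
  have "x \<in> X closure_of K"
    using assms by (auto simp: in_closure_of)
  then show ?thesis
    using assms(1) by (simp add: closure_of_closedin)
qed

text \<open>
  The recursion keeps, next to the set \<open>V\<close> chosen last, a neighbourhood \<open>W\<close> of the point that is
  disjoint from it; all later sets are chosen inside \<open>W\<close>. The property \<open>Q\<close> is arbitrary because
  the regularity proof below applies the construction on two levels.
\<close>
lemma disjoint_sequence_towards_point:
  assumes "first_countable X" "x \<in> topspace X"
    and step: "\<And>U. openin X U \<Longrightarrow> x \<in> U \<Longrightarrow>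
      \<exists>V W. V \<subseteq> U \<and> Q V \<and> openin X W \<and> x \<in> W \<and> disjnt V W"
  obtains V :: "nat \<Rightarrow> 'a set"
  where "\<And>n. Q (V n)" "\<And>i j. i \<noteq> j \<Longrightarrow> disjnt (V i) (V j)"
    "\<And>U. openin X U \<Longrightarrow> x \<in> U \<Longrightarrow> \<exists>n. V n \<subseteq> U"
proof -
  obtain B :: "nat \<Rightarrow> 'a set" where B: "\<And>n. openin X (B n)" "\<And>n. x \<in> B n"
    "\<And>U. openin X U \<Longrightarrow> x \<in> U \<Longrightarrow> \<exists>n. B n \<subseteq> U"
    using local_base_sequence assms by metis
  define P where "P = (\<lambda>n (V, W). Q V \<and> openin X W \<and> x \<in> W \<and> disjnt V W \<and> V \<subseteq> B n)"
  define R where "R = (\<lambda>(V::'a set, W) (V', W'). V' \<subseteq> W \<and> W' \<subseteq> (W::'a set))"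
  have "\<exists>f. \<forall>n. P n (f n) \<and> R (f n) (f (Suc n))"
  proof (rule dependent_nat_choice)
    show "\<exists>s. P 0 s"
      using step[OF B(1,2), of 0] by (fastforce simp: P_def)
    show "\<exists>t. P (Suc n) t \<and> R s t" if "P n s" for n s
    proof -
      obtain V W where s: "s = (V, W)" by force
      have W: "openin X W" "x \<in> W" using that by (auto simp: P_def s)
      then obtain V' W' where *: "V' \<subseteq> W \<inter> B (Suc n)" "Q V'" "openin X W'" "x \<in> W'" "disjnt V' W'"
        using step[of "W \<inter> B (Suc n)"] B by blast
      have "P (Suc n) (V', W \<inter> W') \<and> R s (V', W \<inter> W')"
        using * W by (auto simp: P_def R_def s disjnt_def)
      then show ?thesis ..
    qed
  qed
  then obtain f where f: "\<And>n. P n (f n)" "\<And>n. R (f n) (f (Suc n))"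
    by blast
  define V W where "V = fst \<circ> f" and "W = snd \<circ> f"
  have P: "Q (V n) \<and> openin X (W n) \<and> x \<in> W n \<and> disjnt (V n) (W n) \<and> V n \<subseteq> B n" for n
    using f(1)[of n] by (simp add: P_def V_def W_def case_prod_beta)
  have R: "V (Suc n) \<subseteq> W n" "W (Suc n) \<subseteq> W n" for n
    using f(2)[of n] by (simp_all add: R_def V_def W_def case_prod_beta)
  have VW: "V j \<subseteq> W i" if "i < j" for i j
  proof -
    obtain k where k: "j = Suc k" "i \<le> k"
      using \<open>i < j\<close> by (metis less_Suc_eq_le lessE nat_less_le)
    have "W k \<subseteq> W i"
      using R(2) k(2) by (rule lift_Suc_antimono_le)
    then show ?thesis
      using R(1) k(1) by blast
  qed
  have less: "disjnt (V i) (V j)" if "i < j" for i j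
    using VW[OF that] P[of i] by (auto simp: disjnt_def)
  show thesis
  proof (rule that[of V])
    show "Q (V n)" for n using P by blast
    show "disjnt (V i) (V j)" if "i \<noteq> j" for i j
      using that less disjnt_sym by (metis linorder_neqE_nat)
    show "\<exists>n. V n \<subseteq> U" if "openin X U" "x \<in> U" for U
      using B(3)[OF that] P by blast
  qed
qed

text \<open>
  A point in the closure of an open set but not in it has points of that set in each of its
  neighbourhoods, all different from itself, and the Hausdorff property separates them from it.
\<close>
lemma disjoint_local_pi_base:
  assumes "first_countable X" "Hausdorff_space X"
    and "openin X G" "y \<in> X closure_of G" "y \<notin> G"
  obtains V :: "nat \<Rightarrow> 'a set"
  where "\<And>n. openin X (V n) \<and> V n \<noteq> {} \<and> V n \<subseteq> G"
    "\<And>i j. i \<noteq> j \<Longrightarrow> disjnt (V i) (V j)"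
    "\<And>U. openin X U \<Longrightarrow> y \<in> U \<Longrightarrow> \<exists>n. V n \<subseteq> U"
proof -
  have y: "y \<in> topspace X" "\<And>U. openin X U \<Longrightarrow> y \<in> U \<Longrightarrow> \<exists>z\<in>G. z \<in> U"
    using assms(4) by (auto simp: in_closure_of)
  have "\<exists>V W. V \<subseteq> U \<and> (openin X V \<and> V \<noteq> {} \<and> V \<subseteq> G) \<and> openin X W \<and> y \<in> W \<and> disjnt V W"
    if U: "openin X U" "y \<in> U" for U
  proof -
    obtain z where z: "z \<in> G" "z \<in> U"
      using y(2)[OF U] by blast
    then have "z \<in> topspace X" "z \<noteq> y"
      using assms(3,5) openin_subset by auto
    then obtain N W where NW: "openin X N" "openin X W" "z \<in> N" "y \<in> W" "disjnt N W"
      using assms(2) y(1) unfolding Hausdorff_space_def by meson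
    show ?thesis
      by (rule exI[of _ "U \<inter> G \<inter> N"], rule exI[of _ W])
        (use NW z U assms(3) in \<open>auto simp: disjnt_def\<close>)
  qed
  from disjoint_sequence_towards_point[OF assms(1) y(1) this]
  show thesis using that by metis
qed

text \<open>
  If \<open>a\<close> cannot be separated from the closed set \<open>C\<close>, then disjoint open sets \<open>V n\<close> can be chosen
  arbitrarily close to \<open>a\<close> so that the closure of each contains a point \<open>y n\<close> of \<open>C\<close>. Disjoint
  \<open>\<pi>\<close>-bases at the points \<open>y n\<close> inside the sets \<open>V n\<close> together form a cellular family, so one
  compact set contains all the \<open>y n\<close>. Its intersection with \<open>C\<close> is compact, hence has a
  neighbourhood disjoint from some neighbourhood of \<open>a\<close>, and the latter contains some \<open>V n\<close>:
  a contradiction, as \<open>y n\<close> is in the closure of \<open>V n\<close>.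
\<close>
lemma first_countable_cellular_compact_imp_regular:
  assumes fc: "first_countable X" and T2: "Hausdorff_space X" and cc: "cellular_compact X"
  shows "regular_space X"
  unfolding regular_space_def
proof (intro allI impI, elim conjE)
  fix C a
  assume C: "closedin X C" and a: "a \<in> topspace X - C"
  show "\<exists>U V. openin X U \<and> openin X V \<and> a \<in> U \<and> C \<subseteq> V \<and> disjnt U V"
  proof (rule ccontr)
    assume nosep: "\<not> ?thesis"
    have touch: "\<exists>y\<in>C. y \<in> X closure_of U" if U: "openin X U" "a \<in> U" for U
    proof (rule ccontr)
      assume *: "\<not> ?thesis"
      have "U \<subseteq> X closure_of U"
        using U(1) by (simp add: closure_of_subset openin_subset)
      then have "openin X U \<and> openin X (topspace X - X closure_of U) \<and> a \<in> U
          \<and> C \<subseteq> topspace X - X closure_of U \<and> disjnt U (topspace X - X closure_of U)"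
        using * U closedin_subset[OF C] by (auto simp: disjnt_def)
      then show False
        using nosep by blast
    qed
    \<comment> \<open>The witness \<open>y \<notin> V\<close> makes \<open>y\<close> a limit of points of \<open>V\<close> other than itself, as a disjoint
        \<open>\<pi>\<close>-base at \<open>y\<close> inside \<open>V\<close> requires; removing \<open>C\<close> from the sets below ensures it.\<close>
    define Q where "Q = (\<lambda>V. openin X V \<and> (\<exists>y\<in>C. y \<in> X closure_of V \<and> y \<notin> V))"
    have "\<exists>V W. V \<subseteq> U \<and> Q V \<and> openin X W \<and> a \<in> W \<and> disjnt V W"
      if U: "openin X U" "a \<in> U" for U
    proof -
      define U' where "U' = U - C"
      have U': "openin X U'" "a \<in> U'"
        using U C a by (auto simp: U'_def)
      obtain y where y: "y \<in> C" "y \<in> X closure_of U'"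
        using touch[OF U'] by blast
      then have "y \<in> topspace X" "y \<noteq> a"
        using a by (auto simp: in_closure_of)
      then obtain N W where NW: "openin X N" "openin X W" "y \<in> N" "a \<in> W" "disjnt N W"
        using T2 a unfolding Hausdorff_space_def by (metis DiffD1)
      have "y \<in> X closure_of (N \<inter> U')"
        using openin_Int_closure_of_subset[OF NW(1), of U'] NW(3) y(2) by blast
      then have "Q (N \<inter> U')"
        using y(1) NW(1) U'(1) unfolding Q_def U'_def by blast
      moreover have "N \<inter> U' \<subseteq> U" "disjnt (N \<inter> U') W"
        using NW(5) by (auto simp: U'_def disjnt_def)
      ultimately show ?thesis
        using NW(2,4) by blast
    qed
    from disjoint_sequence_towards_point[OF fc _ this] a
    obtain V :: "nat \<Rightarrow> 'a set" where V: "\<And>n. Q (V n)" "\<And>i j. i \<noteq> j \<Longrightarrow> disjnt (V i) (V j)"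
      "\<And>U. openin X U \<Longrightarrow> a \<in> U \<Longrightarrow> \<exists>n. V n \<subseteq> U"
      by (metis DiffD1)
    obtain y where y: "\<And>n. y n \<in> C" "\<And>n. y n \<in> X closure_of V n" "\<And>n. y n \<notin> V n"
      using V(1) unfolding Q_def by metis
    have Vop: "openin X (V n)" for n
      using V(1) unfolding Q_def by blast
    have "\<exists>W :: nat \<Rightarrow> 'a set. (\<forall>i. openin X (W i) \<and> W i \<noteq> {} \<and> W i \<subseteq> V n) \<and>
        (\<forall>i j. i \<noteq> j \<longrightarrow> disjnt (W i) (W j)) \<and>
        (\<forall>U. openin X U \<longrightarrow> y n \<in> U \<longrightarrow> (\<exists>i. W i \<subseteq> U))" for n
      by (rule disjoint_local_pi_base[OF fc T2 Vop y(2) y(3), of n]) blast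
    then obtain W :: "nat \<Rightarrow> nat \<Rightarrow> 'a set" where
      W: "\<And>n i. openin X (W n i) \<and> W n i \<noteq> {} \<and> W n i \<subseteq> V n"
        "\<And>n i j. i \<noteq> j \<Longrightarrow> disjnt (W n i) (W n j)"
        "\<And>n U. openin X U \<Longrightarrow> y n \<in> U \<Longrightarrow> \<exists>i. W n i \<subseteq> U"
      by metis
    have "disjnt (W n i) (W m j)" if "W n i \<noteq> W m j" for n i m j
    proof (cases "n = m")
      case True
      then show ?thesis using that W(2) by metis
    next
      case False
      then show ?thesis
        using V(2)[of n m] W(1)[of n i] W(1)[of m j] by (auto simp: disjnt_def)
    qed
    then have "cellular_family X (\<Union>n. range (W n))"
      using W(1) unfolding cellular_family_def pairwise_def by blast
    then obtain K where K: "compactin X K" and "\<forall>U\<in>\<Union>n. range (W n). K \<inter> U \<noteq> {}"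
      using cc unfolding cellular_compact_def by blast
    then have KW: "K \<inter> W n i \<noteq> {}" for n i
      by blast
    have yK: "y n \<in> K" for n
    proof (rule closedin_memI)
      show "closedin X K"
        using T2 K by (rule compactin_imp_closedin)
      show "y n \<in> topspace X"
        using y(2) by (auto simp: in_closure_of)
      show "K \<inter> U \<noteq> {}" if "openin X U" "y n \<in> U" for U
        using W(3)[OF that] KW[of n] by blast
    qed
    have "compactin X (K \<inter> C)"
      using K C by (simp add: compact_Int_closedin)
    moreover have "compactin X {a}" "disjnt {a} (K \<inter> C)"
      using a by auto
    ultimately obtain U N where UN: "openin X U" "openin X N" "{a} \<subseteq> U" "K \<inter> C \<subseteq> N" "disjnt U N"
      using Hausdorff_space_compact_separation[OF T2] by metis
    then obtain n where n: "V n \<subseteq> U"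
      using V(3)[of U] by blast
    have "y n \<in> N"
      using yK y(1) UN(4) by blast
    then obtain z where "z \<in> V n" "z \<in> N"
      using y(2)[of n] UN(2) by (auto simp: in_closure_of)
    then show False
      using n UN(5) by (auto simp: disjnt_def)
  qed
qed

section \<open>Martin's axiom for countable partial orders from the covering number\<close>

lemma nowhere_denseI:
  assumes "\<And>G. open G \<Longrightarrow> G \<noteq> {} \<Longrightarrow> \<exists>H. open H \<and> H \<noteq> {} \<and> H \<subseteq> G \<and> H \<inter> N = {}"
  shows "nowhere_dense N"
  unfolding nowhere_dense_def
proof (rule ccontr)
  assume "interior (closure N) \<noteq> {}"
  then obtain H where "open H" "H \<noteq> {}" "H \<subseteq> interior (closure N)" "H \<inter> N = {}"
    using assms[of "interior (closure N)"] by blast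
  then show False
    using interior_subset[of "closure N"] open_Int_closure_eq_empty[of H N] by blast
qed

lemma nowhere_dense_imp_meager: "nowhere_dense N \<Longrightarrow> meager N"
  unfolding meager_def by (rule exI[of _ "{N}"]) simp

text \<open>
  A walk down a partial order that is steered by binary digits: of the condition \<open>e k\<close> proposed at
  time \<open>k\<close>, digit 1 means that it is accepted whenever it extends the current one, digit 0 that it
  is ignored. The digits are the last \<open>k\<close> binary digits of \<open>m\<close>, the most significant one first,
  so \<open>m div 2\<close> encodes the history one step earlier. Using an integer instead of a
  sequence of digits lets \<open>m = \<lfloor>2 ^ k * x\<rfloor>\<close> represent the first \<open>k\<close> binary places of a real \<open>x\<close>.
\<close>
primrec guided_descent :: "('p \<Rightarrow> 'p \<Rightarrow> bool) \<Rightarrow> (nat \<Rightarrow> 'p) \<Rightarrow> 'p \<Rightarrow> nat \<Rightarrow> int \<Rightarrow> 'p" where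
  "guided_descent le e p 0 m = p"
| "guided_descent le e p (Suc k) m =
     (let q = guided_descent le e p k (m div 2) in if odd m \<and> le (e k) q then e k else q)"

lemma guided_descent_zeros:
  "guided_descent le e p (k + i) (m * 2 ^ i) = guided_descent le e p k m"
  by (induction i) (simp_all add: Let_def)

lemma floor_dyadic_div: "\<lfloor>2 ^ k * x\<rfloor> = \<lfloor>2 ^ (k + i) * x\<rfloor> div 2 ^ i" for x :: real
proof -
  have "2 ^ k * x = 2 ^ (k + i) * x / real_of_int (2 ^ i)"
    by (simp add: power_add)
  then show ?thesis
    by (metis floor_divide_real_eq_div zero_le_numeral zero_le_power)
qed

text \<open>
  Every real number \<open>x\<close> steers a descending sequence through \<open>P\<close> by its binary expansion. Given
  a dense set \<open>D i\<close>, the reals whose sequence misses \<open>D i\<close> form a nowhere dense set: in a dyadic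
  interval fixing the first \<open>k\<close> steps, enough zeros followed by a single digit 1 single out a
  smaller interval whose points make the walk accept an extension that belongs to \<open>D i\<close>. Fewer
  than \<^term>\<open>cov_meager\<close> such sets do not cover the real line. A descending sequence takes
  the place of a filter, which it generates.
\<close>
lemma MA_countable:
  fixes P :: "'p set" and le :: "'p \<Rightarrow> 'p \<Rightarrow> bool" and D :: "'i \<Rightarrow> 'p set"
  assumes "countable P" "P \<noteq> {}"
    and refl: "\<And>p. p \<in> P \<Longrightarrow> le p p"
    and dense: "\<And>i p. i \<in> I \<Longrightarrow> p \<in> P \<Longrightarrow> \<exists>q\<in>D i. q \<in> P \<and> le q p"
    and small: "|I| <o cov_meager"
  obtains c :: "nat \<Rightarrow> 'p"
  where "\<And>k. c k \<in> P" "\<And>k. le (c (Suc k)) (c k)" "\<And>i. i \<in> I \<Longrightarrow> \<exists>k. c k \<in> D i"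
proof -
  \<comment> \<open>An enumeration in which each condition recurs infinitely often, so that it can be proposed
      after any given number of steps.\<close>
  define e where "e = (\<lambda>k. from_nat_into P (fst (prod_decode k)))"
  have eP: "e k \<in> P" for k
    using assms(2) by (simp add: e_def from_nat_into)
  have often: "\<exists>j\<ge>k. e j = p" if "p \<in> P" for p k
  proof -
    obtain n where "from_nat_into P n = p"
      using from_nat_into_surj[OF assms(1) \<open>p \<in> P\<close>] by blast
    then have "e (prod_encode (n, k)) = p"
      by (simp add: e_def)
    then show ?thesis
      using le_prod_encode_2 by blast
  qed
  obtain p where p: "p \<in> P"
    using assms(2) by blast
  define st where "st = guided_descent le e p"
  have st_Suc: "st (Suc k) m = (if odd m \<and> le (e k) (st k (m div 2)) then e k else st k (m div 2))"
    for k m by (simp add: st_def Let_def)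
  have stP: "st k m \<in> P" for k m
  proof (induction k arbitrary: m)
    case 0
    then show ?case by (simp add: st_def p)
  next
    case (Suc k)
    then show ?case by (simp add: st_Suc eP)
  qed
  define c where "c = (\<lambda>x::real. \<lambda>k. st k \<lfloor>2 ^ k * x\<rfloor>)"
  define N where "N = (\<lambda>i. {x. \<forall>k. c x k \<notin> D i})"
  have "nowhere_dense (N i)" if i: "i \<in> I" for i
  proof (rule nowhere_denseI)
    fix G :: "real set"
    assume "open G" "G \<noteq> {}"
    then obtain a r where r: "r > 0" "ball a r \<subseteq> G"
      by (metis ex_in_conv open_contains_ball)
    obtain k where k: "(1/2) ^ k < r"
      using real_arch_pow_inv[OF r(1), of "1/2"] by auto
    define m where "m = \<lfloor>2 ^ k * a\<rfloor>"
    obtain q where q: "q \<in> D i" "q \<in> P" "le q (st k m)"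
      using dense[OF i stP] by blast
    obtain j where j: "j \<ge> k" "e j = q"
      using often[OF q(2)] by blast
    obtain d where d: "j = k + d"
      using j(1) le_Suc_ex by blast
    \<comment> \<open>Append \<open>d\<close> digits 0 and one digit 1 to the first \<open>k\<close> places of \<open>a\<close>.\<close>
    define m' where "m' = 2 * (m * 2 ^ d) + 1"
    have "st j (m * 2 ^ d) = st k m"
      unfolding st_def d by (rule guided_descent_zeros)
    then have stq: "st (Suc j) m' = q"
      using q(3) j(2) by (simp add: st_Suc m'_def)
    define H where "H = {of_int m' / 2 ^ Suc j <..< (of_int m' + 1) / 2 ^ Suc j :: real}"
    have fl: "\<lfloor>2 ^ Suc j * x\<rfloor> = m'" if "x \<in> H" for x
      using that unfolding H_def floor_eq_iff greaterThanLessThan_iff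
      by (simp add: field_simps)
    have "x \<in> G" if x: "x \<in> H" for x
    proof -
      have "\<lfloor>2 ^ k * x\<rfloor> = m' div 2 ^ Suc d"
        using floor_dyadic_div[of k x "Suc d"] fl[OF x] by (simp add: d)
      also have "\<dots> = m"
        by (simp add: m'_def zdiv_zmult2_eq)
      finally have "\<bar>2 ^ k * x - 2 ^ k * a\<bar> < 1"
        unfolding m_def by linarith
      then have "2 ^ k * \<bar>x - a\<bar> < 1"
        by (simp add: abs_mult flip: right_diff_distrib)
      then have "\<bar>x - a\<bar> < (1/2) ^ k"
        by (simp add: field_simps)
      then show ?thesis
        using k r(2) by (auto simp: dist_real_def)
    qed
    moreover have "H \<inter> N i = {}"
    proof -
      have "c x (Suc j) = q" if "x \<in> H" for x
        using fl[OF that] stq unfolding c_def by simp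
      then show ?thesis
        using q(1) by (auto simp: N_def)
    qed
    moreover have "open H" "H \<noteq> {}"
      by (auto simp: H_def divide_le_cancel)
    ultimately show "\<exists>H. open H \<and> H \<noteq> {} \<and> H \<subseteq> G \<and> H \<inter> N i = {}"
      by blast
  qed
  then have meag: "\<forall>A\<in>N ` I. meager A"
    using nowhere_dense_imp_meager by blast
  have "\<Union>(N ` I) \<noteq> UNIV"
  proof
    assume "\<Union>(N ` I) = UNIV"
    then have "cov_meager \<le>o |N ` I|"
      using meag by (intro cov_meager_le) (simp add: meager_cover_of_reals_def)
    also have "|N ` I| \<le>o |I|"
      by (rule card_of_image)
    finally show False
      using small not_ordLess_ordLeq by blast
  qed
  then obtain x where x: "\<And>i. i \<in> I \<Longrightarrow> x \<notin> N i"
    by blast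
  show thesis
  proof (rule that[of "c x"])
    show "c x k \<in> P" for k
      by (simp add: c_def stP)
    show "le (c x (Suc k)) (c x k)" for k
    proof -
      define m where "m = \<lfloor>2 ^ Suc k * x\<rfloor>"
      have "\<lfloor>2 ^ k * x\<rfloor> = m div 2"
        using floor_dyadic_div[of k x 1] by (simp add: m_def)
      then have "c x k = st k (m div 2)" "c x (Suc k) = st (Suc k) m"
        by (simp_all add: c_def m_def)
      then show ?thesis
        using refl[OF stP] by (simp add: st_Suc)
    qed
    show "\<exists>k. c x k \<in> D i" if "i \<in> I" for i
      using x[OF that] by (auto simp: N_def)
  qed
qed

section \<open>Small subsets of nowhere dense closed sets\<close>

lemma separable_first_countable_pi_base:
  assumes "first_countable X" "separable_space X"
  obtains \<B> :: "'a set set"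
  where "countable \<B>" "\<And>B. B \<in> \<B> \<Longrightarrow> openin X B \<and> B \<noteq> {}"
    "\<And>U. openin X U \<Longrightarrow> U \<noteq> {} \<Longrightarrow> \<exists>B\<in>\<B>. B \<subseteq> U"
proof -
  obtain D where D: "countable D" "D \<subseteq> topspace X" "X closure_of D = topspace X"
    using assms(2) unfolding separable_space_def by blast
  have "\<exists>B :: nat \<Rightarrow> 'a set. (\<forall>n. openin X (B n) \<and> d \<in> B n) \<and>
      (\<forall>U. openin X U \<longrightarrow> d \<in> U \<longrightarrow> (\<exists>n. B n \<subseteq> U))" if "d \<in> D" for d
  proof -
    have "d \<in> topspace X"
      using that D(2) by blast
    from local_base_sequence[OF assms(1) this] show ?thesis
      by metis
  qed
  then obtain B :: "'a \<Rightarrow> nat \<Rightarrow> 'a set"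
    where B: "\<And>d n. d \<in> D \<Longrightarrow> openin X (B d n) \<and> d \<in> B d n"
      "\<And>d U. d \<in> D \<Longrightarrow> openin X U \<Longrightarrow> d \<in> U \<Longrightarrow> \<exists>n. B d n \<subseteq> U"
    by metis
  show thesis
  proof (rule that[of "\<Union>d\<in>D. range (B d)"])
    show "countable (\<Union>d\<in>D. range (B d))"
      using D(1) by auto
    show "openin X C \<and> C \<noteq> {}" if "C \<in> (\<Union>d\<in>D. range (B d))" for C
      using that B(1) by blast
    show "\<exists>C\<in>\<Union>d\<in>D. range (B d). C \<subseteq> U" if "openin X U" "U \<noteq> {}" for U
    proof -
      have "D \<inter> U \<noteq> {}"
        using that D(3) openin_subset[OF that(1)] by (auto simp: closure_of_def)
      then obtain d n where "d \<in> D" "B d n \<subseteq> U"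
        using B(2)[OF _ \<open>openin X U\<close>] by (metis IntE ex_in_conv)
      then show ?thesis
        by blast
    qed
  qed
qed

text \<open>
  A generic cellular family made of cells whose closures miss \<open>Y\<close> accumulates at every point of
  \<open>S\<close>. The factor \<^typ>\<open>nat\<close> in the cardinality bound counts the requirements: there is one for each
  point of \<open>S\<close> and each member of a countable neighbourhood base at that point.
\<close>
lemma small_subset_of_nowhere_dense_in_compact:
  assumes fc: "first_countable X" and sep: "separable_space X"
    and T2: "Hausdorff_space X" and cc: "cellular_compact X"
    and Y: "closedin X Y" "X interior_of Y = {}"
    and S: "S \<subseteq> Y" "|S \<times> (UNIV :: nat set)| <o cov_meager"
  obtains K where "compactin X K" "S \<subseteq> K"
proof -
  have reg: "regular_space X"
    using fc T2 cc by (rule first_countable_cellular_compact_imp_regular)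
  obtain \<B> where \<B>: "countable \<B>" "\<And>B. B \<in> \<B> \<Longrightarrow> openin X B \<and> B \<noteq> {}"
    "\<And>U. openin X U \<Longrightarrow> U \<noteq> {} \<Longrightarrow> \<exists>B\<in>\<B>. B \<subseteq> U"
    using separable_first_countable_pi_base[OF fc sep] by metis
  have S_X: "S \<subseteq> topspace X"
    using S(1) closedin_subset[OF Y(1)] by blast
  have "\<exists>u :: nat \<Rightarrow> 'a set. (\<forall>n. openin X (u n) \<and> x \<in> u n) \<and>
      (\<forall>U. openin X U \<longrightarrow> x \<in> U \<longrightarrow> (\<exists>n. u n \<subseteq> U))" if "x \<in> S" for x
  proof -
    have "x \<in> topspace X"
      using that S_X by blast
    from local_base_sequence[OF fc this] show ?thesis
      by metis
  qed
  then obtain u :: "'a \<Rightarrow> nat \<Rightarrow> 'a set"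
    where u: "\<And>x n. x \<in> S \<Longrightarrow> openin X (u x n) \<and> x \<in> u x n"
      "\<And>x U. x \<in> S \<Longrightarrow> openin X U \<Longrightarrow> x \<in> U \<Longrightarrow> \<exists>n. u x n \<subseteq> U"
    by metis
  define P where "P = {p. finite p \<and> p \<subseteq> \<B> \<and> pairwise disjnt p \<and> (\<forall>B\<in>p. disjnt Y (X closure_of B))}"
  define D where "D = (\<lambda>(x, n). {p. \<exists>B\<in>p. B \<subseteq> u x n})"
  have "P \<subseteq> {p. finite p \<and> p \<subseteq> \<B>}"
    by (auto simp: P_def)
  then have cntP: "countable P"
    using countable_Collect_finite_subset[OF \<B>(1)] countable_subset by blast
  have "{} \<in> P"
    by (simp add: P_def)
  then have "P \<noteq> {}"
    by blast
  have dense: "\<exists>q\<in>D i. q \<in> P \<and> p \<subseteq> q" if i: "i \<in> S \<times> UNIV" and p: "p \<in> P" for i p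
  proof -
    obtain x n where x: "i = (x, n)" "x \<in> S"
      using i by blast
    define C where "C = \<Union>((closure_of) X ` p)"
    have C: "closedin X C"
      using p by (auto simp: C_def P_def intro!: closedin_Union)
    have "disjnt Y C"
      using p by (auto simp: C_def P_def disjnt_def)
    then have "openin X (u x n - C)" "x \<in> u x n - C"
      using u(1)[OF x(2)] C x(2) S(1) by (auto simp: disjnt_def)
    then have "\<not> u x n - C \<subseteq> Y"
      using Y(2) interior_of_maximal[of "u x n - C" Y X] by blast
    then obtain z where z: "z \<in> u x n - C - Y"
      by blast
    have W: "openin X (u x n - C - Y)"
      using \<open>openin X (u x n - C)\<close> Y(1) by blast
    define F where "F = topspace X - (u x n - C - Y)"
    have "closedin X F" "z \<in> topspace X - F"
      using W z openin_subset[OF W] by (auto simp: F_def)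
    then obtain G where G: "openin X G" "z \<in> G" "disjnt F (X closure_of G)"
      using reg unfolding regular_space by blast
    obtain B where B: "B \<in> \<B>" "B \<subseteq> G"
      using \<B>(3)[OF G(1)] G(2) by blast
    have "X closure_of B \<subseteq> X closure_of G"
      using B(2) by (rule closure_of_mono)
    then have clB: "X closure_of B \<subseteq> u x n - C - Y"
      using G(3) closure_of_subset_topspace[of X B] unfolding F_def disjnt_def by blast
    have BclB: "A \<subseteq> X closure_of A" if "A \<in> \<B>" for A
      using \<B>(2)[OF that] by (simp add: closure_of_subset openin_subset)
    have "disjnt B A" if "A \<in> p" for A
    proof -
      have "A \<subseteq> C"
        using BclB[of A] that p by (auto simp: C_def P_def)
      then show ?thesis
        using clB BclB[OF B(1)] by (auto simp: disjnt_def)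
    qed
    then have "pairwise disjnt (insert B p)"
      using p by (auto simp: P_def pairwise_insert disjnt_sym)
    then have "insert B p \<in> P"
      using p B(1) clB by (auto simp: P_def disjnt_def)
    moreover have "insert B p \<in> D i"
      using clB BclB[OF B(1)] by (auto simp: D_def x(1))
    ultimately show ?thesis
      by blast
  qed
  obtain c where c: "\<And>k :: nat. c k \<in> P" "\<And>k. c k \<subseteq> c (Suc k)"
    "\<And>i. i \<in> S \<times> UNIV \<Longrightarrow> \<exists>k. c k \<in> D i"
    using MA_countable[where le = "\<lambda>q p. p \<subseteq> q" and D = D, OF cntP \<open>P \<noteq> {}\<close> order_refl dense S(2)]
    by blast
  have mono: "c i \<subseteq> c j" if "i \<le> j" for i j
    using c(2) that by (rule lift_Suc_mono_le)
  have "disjnt A B" if "A \<in> c i" "B \<in> c j" "A \<noteq> B" for A B i j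
  proof -
    have "A \<in> c (max i j)" "B \<in> c (max i j)"
      using that mono[of i "max i j"] mono[of j "max i j"] by auto
    then show ?thesis
      using c(1)[of "max i j"] that(3) unfolding P_def pairwise_def by blast
  qed
  then have "pairwise disjnt (\<Union>k. c k)"
    unfolding pairwise_def by blast
  moreover have "\<forall>B\<in>\<Union>k. c k. openin X B \<and> B \<noteq> {}"
    using c(1) \<B>(2) unfolding P_def by blast
  ultimately have "cellular_family X (\<Union>k. c k)"
    unfolding cellular_family_def by blast
  then obtain K where K: "compactin X K" "\<forall>B\<in>\<Union>k. c k. K \<inter> B \<noteq> {}"
    using cc unfolding cellular_compact_def by blast
  have "x \<in> K" if x: "x \<in> S" for x
  proof (rule closedin_memI)
    show "closedin X K"
      using T2 K(1) by (rule compactin_imp_closedin)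
    show "x \<in> topspace X"
      using x S_X by blast
    show "K \<inter> U \<noteq> {}" if U: "openin X U" "x \<in> U" for U
    proof -
      obtain n where n: "u x n \<subseteq> U"
        using u(2)[OF x U] by blast
      obtain k where "c k \<in> D (x, n)"
        using c(3)[of "(x, n)"] x by blast
      then obtain B where "B \<in> c k" "B \<subseteq> u x n"
        by (auto simp: D_def)
      then show ?thesis
        using K(2) n by blast
    qed
  qed
  then show thesis
    using that K(1) by blast
qed

section \<open>Free sequences of length \<open>\<omega>\<^sub>1\<close>\<close>

lemma countable_underS_omega1:
  "countable (underS (cardSuc natLeq) a)"
proof (cases "a \<in> Field (cardSuc natLeq)")
  case True
  then have "|underS (cardSuc natLeq) a| <o cardSuc natLeq"
    by (rule card_of_underS[OF cardSuc_Card_order[OF natLeq_Card_order]])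
  then show ?thesis
    by (simp add: countable_card_le_natLeq cardSuc_ordLeq_ordLess natLeq_Card_order card_of_Card_order)
next
  case False
  then have "underS (cardSuc natLeq) a = {}"
    by (auto simp: underS_def Field_def)
  then show ?thesis
    by simp
qed

lemma uncountable_omega1: "uncountable (Field (cardSuc natLeq))"
proof
  assume "countable (Field (cardSuc natLeq))"
  then have "|Field (cardSuc natLeq)| \<le>o natLeq"
    by (simp add: countable_card_le_natLeq)
  moreover have "|Field (cardSuc natLeq)| =o cardSuc natLeq"
    by (simp add: card_of_Field_ordIso cardSuc_Card_order natLeq_Card_order)
  ultimately have "cardSuc natLeq \<le>o natLeq"
    using ordIso_ordLeq_trans ordIso_symmetric by blast
  then show False
    using cardSuc_greater[OF natLeq_Card_order] not_ordLess_ordLeq by blast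
qed

lemma countable_subset_omega1_bounded:
  assumes "countable A" "A \<subseteq> Field (cardSuc natLeq)"
  obtains m where "m \<in> Field (cardSuc natLeq)" "A \<subseteq> underS (cardSuc natLeq) m"
proof (rule ccontr)
  let ?r = "cardSuc natLeq"
  assume "\<not> thesis"
  then have unbounded: "\<exists>a\<in>A. a \<notin> underS ?r m" if "m \<in> Field ?r" for m
    using that \<open>\<And>m. m \<in> Field ?r \<Longrightarrow> A \<subseteq> underS ?r m \<Longrightarrow> thesis\<close> by blast
  have "Well_order ?r"
    using cardSuc_Card_order[OF natLeq_Card_order] by (simp add: card_order_on_def)
  then have "Total ?r"
    by (auto simp: order_on_defs)
  have "m \<in> (\<Union>a\<in>A. insert a (underS ?r a))" if m: "m \<in> Field ?r" for m
  proof -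
    obtain a where a: "a \<in> A" "a \<notin> underS ?r m"
      using unbounded[OF m] by blast
    then have "m = a \<or> m \<in> underS ?r a"
      using \<open>Total ?r\<close> m assms(2) unfolding underS_def total_on_def by blast
    then show ?thesis
      using a(1) by blast
  qed
  then have "Field ?r \<subseteq> (\<Union>a\<in>A. insert a (underS ?r a))"
    by blast
  moreover have "countable (\<Union>a\<in>A. insert a (underS ?r a))"
    using assms(1) countable_underS_omega1 by simp
  ultimately show False
    using uncountable_omega1 countable_subset by blast
qed

text \<open>
  Close a bad open cover under finite unions. Then compact subsets of \<open>Y\<close> lie inside one member,
  while countably many members never cover \<open>Y\<close>, because countable subsets of \<open>Y\<close> have compact
  closures. So points \<open>x a\<close> and members \<open>U a\<close> can be chosen by recursion along \<open>\<omega>\<^sub>1\<close> with the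
  closure of the earlier points inside \<open>U a\<close>, and \<open>x a\<close> outside \<open>U a\<close> and all earlier members.
  By first countability a point in the closure of all the \<open>x a\<close> is already in the closure of
  countably many of them, which precede a common index; hence the sets \<open>U a\<close> cover this closure.
  It is compact, so finitely many cover it, but these miss every later point \<open>x m\<close>.
\<close>
lemma compactin_if_omega1_subsets_in_compact:
  assumes fc: "first_countable X" and T2: "Hausdorff_space X" and Y: "closedin X Y"
    and small: "\<And>S. S \<subseteq> Y \<Longrightarrow> |S| \<le>o cardSuc natLeq \<Longrightarrow> \<exists>K. compactin X K \<and> S \<subseteq> K"
  shows "compactin X Y"
proof (rule ccontr)
  let ?r = "cardSuc natLeq"
  assume "\<not> compactin X Y"
  then obtain \<C> where \<C>: "\<forall>U\<in>\<C>. openin X U" "Y \<subseteq> \<Union>\<C>"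
    "\<not> (\<exists>\<F>. finite \<F> \<and> \<F> \<subseteq> \<C> \<and> Y \<subseteq> \<Union>\<F>)"
    using closedin_subset[OF Y] unfolding compactin_def by auto
  define \<U> where "\<U> = {\<Union>\<F> |\<F>. finite \<F> \<and> \<F> \<subseteq> \<C>}"
  have U_open: "openin X U" if "U \<in> \<U>" for U
    using that \<C>(1) unfolding \<U>_def by blast
  have U_proper: "\<not> Y \<subseteq> \<Union>\<F>" if "finite \<F>" "\<F> \<subseteq> \<U>" for \<F>
  proof -
    have "\<forall>U\<in>\<F>. \<exists>\<G>. finite \<G> \<and> \<G> \<subseteq> \<C> \<and> U = \<Union>\<G>"
      using that(2) unfolding \<U>_def by blast
    then obtain g where g: "\<And>U. U \<in> \<F> \<Longrightarrow> finite (g U)" "\<And>U. U \<in> \<F> \<Longrightarrow> g U \<subseteq> \<C>"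
        "\<And>U. U \<in> \<F> \<Longrightarrow> U = \<Union>(g U)"
      by metis
    have "finite (\<Union>(g ` \<F>))" "\<Union>(g ` \<F>) \<subseteq> \<C>"
      using g(1,2) that(1) by auto
    moreover have "\<Union>\<F> \<subseteq> \<Union>(\<Union>(g ` \<F>))"
    proof
      fix y assume "y \<in> \<Union>\<F>"
      then obtain U where "U \<in> \<F>" "y \<in> U"
        by blast
      then have "y \<in> \<Union>(g U)"
        using g(3) by blast
      then show "y \<in> \<Union>(\<Union>(g ` \<F>))"
        using \<open>U \<in> \<F>\<close> by blast
    qed
    ultimately show ?thesis
      using \<C>(3) by (meson order_trans)
  qed
  have U_compact: "\<exists>U\<in>\<U>. L \<subseteq> U" if L: "compactin X L" "L \<subseteq> Y" for L
  proof -
    obtain \<F> where "finite \<F>" "\<F> \<subseteq> \<C>" "L \<subseteq> \<Union>\<F>"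
      using L \<C>(1,2) unfolding compactin_def by (meson order_trans)
    then show ?thesis
      unfolding \<U>_def by blast
  qed
  have small_closure: "compactin X (X closure_of S)" if S: "S \<subseteq> Y" "|S| \<le>o ?r" for S
  proof -
    obtain K where K: "compactin X K" "S \<subseteq> K"
      using small[OF S] by blast
    have "X closure_of S \<subseteq> K"
      using K compactin_imp_closedin[OF T2] by (simp add: closure_of_minimal)
    then show ?thesis
      using closed_compactin[OF K(1)] by simp
  qed
  have ctbl_small: "|S| \<le>o ?r" if "countable S" for S :: "'a set"
  proof -
    have "|S| \<le>o natLeq"
      using that by (simp add: countable_card_le_natLeq)
    then show ?thesis
      using cardSuc_greater[OF natLeq_Card_order] ordLeq_ordLess_trans ordLess_imp_ordLeq by blast
  qed
  have closure_Y: "X closure_of S \<subseteq> Y" if "S \<subseteq> Y" for S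
    using that Y by (rule closure_of_minimal)
  have no_countable: "\<not> Y \<subseteq> \<Union>\<V>" if \<V>: "countable \<V>" "\<V> \<subseteq> \<U>" for \<V>
  proof (cases "\<V> = {}")
    case True
    then show ?thesis
      using U_proper[of "{}"] by simp
  next
    case False
    define V where "V = from_nat_into \<V>"
    have V: "range V = \<V>"
      using False \<V>(1) by (simp add: V_def range_from_nat_into)
    have "\<exists>y\<in>Y. y \<notin> \<Union>(V ` {..n})" for n
      using U_proper[of "V ` {..n}"] V \<V>(2) by blast
    then obtain y where y: "\<And>n :: nat. y n \<in> Y" "\<And>n. y n \<notin> \<Union>(V ` {..n})"
      by metis
    have yY: "range y \<subseteq> Y"
      using y(1) by blast
    have cpt: "compactin X (X closure_of range y)"
      using yY by (rule small_closure) (simp add: ctbl_small)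
    show ?thesis
    proof
      assume cover: "Y \<subseteq> \<Union>\<V>"
      have "X closure_of range y \<subseteq> \<Union>(range V)"
        using closure_Y[OF yY] cover V by simp
      moreover have "\<forall>U\<in>range V. openin X U"
        using V \<V>(2) U_open by blast
      ultimately obtain \<F> where \<F>: "finite \<F>" "\<F> \<subseteq> range V" "X closure_of range y \<subseteq> \<Union>\<F>"
        using cpt unfolding compactin_def by meson
      obtain A where A: "finite A" "\<F> = V ` A"
        using finite_subset_image[OF \<F>(1,2)] by blast
      obtain n where n: "A \<subseteq> {..n}"
        using A(1) finite_nat_iff_bounded_le by blast
      have "y n \<in> X closure_of range y"
        using yY closedin_subset[OF Y] closure_of_subset[of "range y" X] by blast
      then have "y n \<in> \<Union>(V ` {..n})"
        using \<F>(3) A(2) n by blast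
      then show False
        using y(2) by blast
    qed
  qed
  have wo: "Well_order ?r"
    using cardSuc_Card_order[OF natLeq_Card_order] by (simp add: card_order_on_def)
  then have wf: "wf (?r - Id)"
    by (simp add: order_on_defs)
  have underS_iff: "z \<in> underS ?r a \<longleftrightarrow> (z, a) \<in> ?r - Id" for z a
    by (auto simp: underS_def)
  \<comment> \<open>The recursion runs over the whole type; at indices outside the field of \<open>\<omega>\<^sub>1\<close> there are
      no predecessors, and the requirements are harmless.\<close>
  define P where "P = (\<lambda>(f :: nat set \<Rightarrow> 'a \<times> 'a set) a (x, U). x \<in> Y \<and> U \<in> \<U> \<and> x \<notin> U \<and>
    X closure_of ((\<lambda>b. fst (f b)) ` underS ?r a) \<subseteq> U \<and> (\<forall>b\<in>underS ?r a. x \<notin> snd (f b)))"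
  have "\<exists>f. \<forall>a. P f a (f a)"
  proof (rule dependent_wf_choice[OF wf])
    fix f g :: "nat set \<Rightarrow> 'a \<times> 'a set" and a s
    assume eq: "\<And>z. (z, a) \<in> ?r - Id \<Longrightarrow> f z = g z"
    then have "f b = g b" if "b \<in> underS ?r a" for b
      using that underS_iff by blast
    then show "P f a s = P g a s"
      by (simp add: P_def case_prod_beta cong: image_cong ball_cong)
  next
    fix a and f :: "nat set \<Rightarrow> 'a \<times> 'a set"
    assume IH: "\<And>b. (b, a) \<in> ?r - Id \<Longrightarrow> P f b (f b)"
    then have IH': "fst (f b) \<in> Y" "snd (f b) \<in> \<U>" if "b \<in> underS ?r a" for b
      using IH[of b] that underS_iff unfolding P_def case_prod_beta by blast+
    define S where "S = (\<lambda>b. fst (f b)) ` underS ?r a"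
    have SY: "S \<subseteq> Y"
      using IH'(1) by (auto simp: S_def)
    have "countable S"
      by (simp add: S_def countable_underS_omega1)
    then have "compactin X (X closure_of S)"
      using SY small_closure ctbl_small by blast
    then obtain U where U: "U \<in> \<U>" "X closure_of S \<subseteq> U"
      using U_compact closure_Y[OF SY] by blast
    define \<V> where "\<V> = insert U ((\<lambda>b. snd (f b)) ` underS ?r a)"
    have "countable \<V>" "\<V> \<subseteq> \<U>"
      using IH'(2) U(1) by (auto simp: \<V>_def countable_underS_omega1)
    then obtain x where "x \<in> Y" "x \<notin> \<Union>\<V>"
      using no_countable by blast
    then have "P f a (x, U)"
      using U by (auto simp: P_def \<V>_def S_def)
    then show "\<exists>s. P f a s" ..
  qed
  then obtain f where f: "\<And>a. P f a (f a)"
    by blast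
  define x U where "x = fst \<circ> f" and "U = snd \<circ> f"
  have xU: "x a \<in> Y" "U a \<in> \<U>" "X closure_of (x ` underS ?r a) \<subseteq> U a" for a
    using f[of a] by (simp_all add: P_def x_def U_def case_prod_beta comp_def)
  have xU_less: "x a \<notin> U b" if "b \<in> underS ?r a" for a b
    using f[of a] that by (simp add: P_def x_def U_def case_prod_beta)
  define S where "S = x ` Field ?r"
  have SY: "S \<subseteq> Y"
    using xU(1) by (auto simp: S_def)
  have "|S| \<le>o |Field ?r|"
    unfolding S_def by (rule card_of_image)
  moreover have "|Field ?r| =o ?r"
    by (simp add: card_of_Field_ordIso cardSuc_Card_order natLeq_Card_order)
  ultimately have "|S| \<le>o ?r"
    by (rule ordLeq_ordIso_trans)
  then have cpt: "compactin X (X closure_of S)"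
    using SY small_closure by blast
  have "z \<in> \<Union>(U ` Field ?r)" if z: "z \<in> X closure_of S" for z
  proof -
    have zX: "z \<in> topspace X" and meets: "\<And>G. openin X G \<Longrightarrow> z \<in> G \<Longrightarrow> \<exists>s\<in>S. s \<in> G"
      using z by (auto simp: in_closure_of)
    obtain B :: "nat \<Rightarrow> 'a set" where B: "\<And>n. openin X (B n)" "\<And>n. z \<in> B n"
      "\<And>G. openin X G \<Longrightarrow> z \<in> G \<Longrightarrow> \<exists>n. B n \<subseteq> G"
      using local_base_sequence[OF fc zX] by metis
    have "\<exists>t\<in>Field ?r. x t \<in> B n" for n
      using meets[OF B(1,2)] unfolding S_def by blast
    then obtain t where t: "\<And>n. t n \<in> Field ?r" "\<And>n. x (t n) \<in> B n"
      by metis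
    have "countable (range t)" "range t \<subseteq> Field ?r"
      using t(1) by auto
    then obtain m where m: "m \<in> Field ?r" "range t \<subseteq> underS ?r m"
      by (rule countable_subset_omega1_bounded)
    have "\<exists>s\<in>x ` underS ?r m. s \<in> G" if G: "openin X G" "z \<in> G" for G
    proof -
      obtain n where "B n \<subseteq> G"
        using B(3)[OF G] by blast
      then show ?thesis
        using t(2)[of n] m(2) by blast
    qed
    then have "z \<in> X closure_of (x ` underS ?r m)"
      using zX by (auto simp: in_closure_of)
    then show ?thesis
      using xU(3) m(1) by blast
  qed
  then have "X closure_of S \<subseteq> \<Union>(U ` Field ?r)"
    by blast
  moreover have "\<forall>G\<in>U ` Field ?r. openin X G"
    using xU(2) U_open by blast
  ultimately obtain \<F> where \<F>: "finite \<F>" "\<F> \<subseteq> U ` Field ?r" "X closure_of S \<subseteq> \<Union>\<F>"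
    using cpt unfolding compactin_def by meson
  obtain A where A: "finite A" "A \<subseteq> Field ?r" "\<F> = U ` A"
    using finite_subset_image[OF \<F>(1,2)] by blast
  \<comment> \<open>The finite set \<open>A\<close> of indices is in particular countable, so \<open>m\<close> lies beyond all of it.\<close>
  obtain m where m: "m \<in> Field ?r" "A \<subseteq> underS ?r m"
    by (rule countable_subset_omega1_bounded[OF countable_finite[OF A(1)] A(2)])
  have "x m \<in> X closure_of S"
    using m(1) SY closedin_subset[OF Y] closure_of_subset[of S X] by (auto simp: S_def)
  then obtain a where "a \<in> A" "x m \<in> U a"
    using \<F>(3) A(3) by blast
  then show False
    using xU_less m(2) by blast
qed

section \<open>From nowhere dense closed sets to the whole space\<close>

lemma maximal_cellular_refinement:
  assumes "\<And>U. U \<in> \<U> \<Longrightarrow> openin X U" "topspace X \<subseteq> \<Union>\<U>"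
  obtains \<V> where "cellular_family X \<V>" "\<And>V. V \<in> \<V> \<Longrightarrow> \<exists>U\<in>\<U>. V \<subseteq> U"
    "X interior_of (topspace X - \<Union>\<V>) = {}"
proof -
  define \<A> where "\<A> = {\<V>. cellular_family X \<V> \<and> (\<forall>V\<in>\<V>. \<exists>U\<in>\<U>. V \<subseteq> U)}"
  have "\<exists>\<V>\<in>\<A>. \<forall>\<W>\<in>\<A>. \<V> \<subseteq> \<W> \<longrightarrow> \<W> = \<V>"
  proof (rule subset_Zorn')
    fix \<C> assume "subset.chain \<A> \<C>"
    then have C: "\<C> \<subseteq> \<A>" "chain\<^sub>\<subseteq> \<C>"
      by (auto simp: subset_chain_def chain_subset_def)
    have "pairwise disjnt (\<Union>\<C>)"
      by (rule pairwise_chain_Union[OF _ C(2)]) (use C(1) in \<open>auto simp: \<A>_def cellular_family_def\<close>)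
    then show "\<Union>\<C> \<in> \<A>"
      using C(1) unfolding \<A>_def cellular_family_def by blast
  qed
  then obtain \<V> where \<V>: "\<V> \<in> \<A>" "\<And>\<W>. \<W> \<in> \<A> \<Longrightarrow> \<V> \<subseteq> \<W> \<Longrightarrow> \<W> = \<V>"
    by blast
  have "X interior_of (topspace X - \<Union>\<V>) = {}"
  proof (rule ccontr)
    define G where "G = X interior_of (topspace X - \<Union>\<V>)"
    assume "X interior_of (topspace X - \<Union>\<V>) \<noteq> {}"
    then obtain g where g: "g \<in> G"
      by (auto simp: G_def)
    have G: "openin X G" "G \<inter> \<Union>\<V> = {}"
      using interior_of_subset[of X "topspace X - \<Union>\<V>"] by (auto simp: G_def)
    have "g \<in> topspace X"
      using g openin_subset[OF G(1)] by blast
    then obtain U where U: "U \<in> \<U>" "g \<in> U"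
      using assms(2) by blast
    have "openin X (G \<inter> U)" "G \<inter> U \<noteq> {}"
      using G(1) assms(1)[OF U(1)] g U(2) by auto
    moreover have "\<forall>V\<in>\<V>. disjnt (G \<inter> U) V"
      using G(2) by (auto simp: disjnt_def)
    ultimately have "insert (G \<inter> U) \<V> \<in> \<A>"
      using \<V>(1) U(1) by (auto simp: \<A>_def cellular_family_def pairwise_insert disjnt_sym)
    then have "G \<inter> U \<in> \<V>"
      using \<V>(2) by blast
    then show False
      using G(2) g U(2) by blast
  qed
  then show thesis
    using that \<V>(1) unfolding \<A>_def by blast
qed

text \<open>
  Up to the closure of an open set \<open>U\<close> that is a finite union of members of the cover, the space
  is a disjoint union of cells, each inside a member. Cellular-compactness applied to the traces
  of the cells outside the closure of \<open>U\<close> shows that only finitely many of them are non-empty.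
\<close>
lemma cellular_compact_imp_compact_if_nowhere_dense_compact:
  assumes cc: "cellular_compact X"
    and nd: "\<And>Y. closedin X Y \<Longrightarrow> X interior_of Y = {} \<Longrightarrow> compactin X Y"
  shows "compact_space X"
  unfolding compact_space_alt
proof (intro allI impI, elim conjE)
  fix \<U> assume \<U>: "\<forall>U\<in>\<U>. openin X U" "topspace X \<subseteq> \<Union>\<U>"
  obtain \<V> where \<V>: "cellular_family X \<V>" "\<And>V. V \<in> \<V> \<Longrightarrow> \<exists>U\<in>\<U>. V \<subseteq> U"
    "X interior_of (topspace X - \<Union>\<V>) = {}"
    using maximal_cellular_refinement[of \<U> X] \<U> by blast
  have \<V>_open: "openin X V" if "V \<in> \<V>" for V
    using \<V>(1) that by (auto simp: cellular_family_def)
  have finite_cover: "\<exists>\<F>. finite \<F> \<and> \<F> \<subseteq> \<U> \<and> Y \<subseteq> \<Union>\<F>"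
    if Y: "closedin X Y" "X interior_of Y = {}" for Y
  proof -
    have "Y \<subseteq> \<Union>\<U>"
      using \<U>(2) closedin_subset[OF Y(1)] by blast
    then show ?thesis
      using nd[OF Y] \<U>(1) unfolding compactin_def by meson
  qed
  have "closedin X (topspace X - \<Union>\<V>)"
    using \<V>_open by (intro closedin_diff) auto
  then obtain \<F> where \<F>: "finite \<F>" "\<F> \<subseteq> \<U>" "topspace X - \<Union>\<V> \<subseteq> \<Union>\<F>"
    using finite_cover \<V>(3) by meson
  define U where "U = \<Union>\<F>"
  have U: "openin X U"
    using \<F>(2) \<U>(1) by (auto simp: U_def)
  have frontier: "X interior_of (X frontier_of U) = {}"
  proof (rule ccontr)
    assume "X interior_of (X frontier_of U) \<noteq> {}"
    then obtain z where z: "z \<in> X interior_of (X frontier_of U)"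
      by blast
    then have "z \<in> X closure_of U"
      using interior_of_subset[of X "X frontier_of U"] by (auto simp: frontier_of_def)
    then obtain y where "y \<in> U" "y \<in> X interior_of (X frontier_of U)"
      using z by (auto simp: in_closure_of)
    then have "y \<in> U" "y \<in> X frontier_of U"
      using interior_of_subset[of X "X frontier_of U"] by auto
    then show False
      using U by (simp add: frontier_of_def interior_of_openin)
  qed
  then obtain \<G> where \<G>: "finite \<G>" "\<G> \<subseteq> \<U>" "X frontier_of U \<subseteq> \<Union>\<G>"
    using finite_cover[OF closedin_frontier_of frontier] by meson
  have clU: "U \<subseteq> X closure_of U" "X closure_of U \<subseteq> U \<union> X frontier_of U"
    using U openin_subset[OF U] by (auto simp: closure_of_subset frontier_of_def interior_of_openin)
  define \<W> where "\<W> = {V - X closure_of U |V. V \<in> \<V> \<and> \<not> V \<subseteq> X closure_of U}"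
  have "openin X W \<and> W \<noteq> {}" if "W \<in> \<W>" for W
  proof -
    obtain V where V: "V \<in> \<V>" "\<not> V \<subseteq> X closure_of U" "W = V - X closure_of U"
      using \<open>W \<in> \<W>\<close> by (auto simp: \<W>_def)
    then show ?thesis
      using \<V>_open[OF V(1)] by auto
  qed
  moreover have "pairwise disjnt \<W>"
  proof (rule pairwiseI)
    fix W W' assume W: "W \<in> \<W>" "W' \<in> \<W>" "W \<noteq> W'"
    obtain V V' where V: "V \<in> \<V>" "V' \<in> \<V>" "W = V - X closure_of U" "W' = V' - X closure_of U"
      using W(1,2) by (auto simp: \<W>_def)
    then have "disjnt V V'"
      using W(3) \<V>(1) unfolding cellular_family_def pairwise_def by blast
    then show "disjnt W W'"
      unfolding V(3,4) by (auto simp: disjnt_def)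
  qed
  ultimately have "cellular_family X \<W>"
    unfolding cellular_family_def by blast
  then obtain K where K: "compactin X K" "\<forall>W\<in>\<W>. K \<inter> W \<noteq> {}"
    using cc unfolding cellular_compact_def by blast
  have "compactin X (K \<inter> (topspace X - U))"
    using K(1) U by (intro compact_Int_closedin) auto
  moreover have "K \<inter> (topspace X - U) \<subseteq> \<Union>\<V>"
    using \<F>(3) unfolding U_def by blast
  ultimately obtain \<V>' where \<V>': "finite \<V>'" "\<V>' \<subseteq> \<V>" "K \<inter> (topspace X - U) \<subseteq> \<Union>\<V>'"
    using \<V>_open unfolding compactin_def by meson
  obtain g where g: "\<And>V. V \<in> \<V> \<Longrightarrow> g V \<in> \<U> \<and> V \<subseteq> g V"
    using \<V>(2) by metis
  have outside: "x \<in> \<Union>\<V>'" if x: "x \<in> topspace X" "x \<notin> X closure_of U" for x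
  proof -
    have "x \<notin> U"
      using x(2) clU(1) by blast
    then obtain V where V: "V \<in> \<V>" "x \<in> V"
      using x(1) \<F>(3) unfolding U_def by blast
    then have "V - X closure_of U \<in> \<W>"
      using x(2) unfolding \<W>_def by blast
    then obtain z where z: "z \<in> K" "z \<in> V" "z \<notin> X closure_of U"
      using K(2) by blast
    then have "z \<in> K \<inter> (topspace X - U)"
      using clU(1) compactin_subset_topspace[OF K(1)] by blast
    then obtain V' where V': "V' \<in> \<V>'" "z \<in> V'"
      using \<V>'(3) by blast
    then have "V' \<in> \<V>" "\<not> disjnt V' V"
      using z(2) \<V>'(2) by (auto simp: disjnt_def)
    then have "V' = V"
      using V(1) \<V>(1) unfolding cellular_family_def pairwise_def by blast
    then show ?thesis
      using V' V by blast
  qed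
  have "topspace X \<subseteq> \<Union>(\<F> \<union> \<G> \<union> g ` \<V>')"
  proof
    fix x assume x: "x \<in> topspace X"
    show "x \<in> \<Union>(\<F> \<union> \<G> \<union> g ` \<V>')"
    proof (cases "x \<in> X closure_of U")
      case True
      then show ?thesis
        using clU(2) \<G>(3) unfolding U_def by blast
    next
      case False
      then show ?thesis
        using outside[OF x] g \<V>'(2) by blast
    qed
  qed
  moreover have "\<F> \<union> \<G> \<union> g ` \<V>' \<subseteq> \<U>"
    using \<F>(2) \<G>(2) g \<V>'(2) by blast
  ultimately show "\<exists>\<F>. finite \<F> \<and> \<F> \<subseteq> \<U> \<and> topspace X \<subseteq> \<Union>\<F>"
    using \<F>(1) \<G>(1) \<V>'(1) by (meson finite_UnI finite_imageI)
qed

section \<open>Compactness\<close>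

theorem theorem3p1:
  fixes X :: "'a topology"
  assumes "cardSuc natLeq <o cov_meager"
    and "first_countable X"
    and "separable_space X"
    and "cellular_compact X"
    and "Hausdorff_space X"
  shows "compact_space X"
proof (rule cellular_compact_imp_compact_if_nowhere_dense_compact[OF assms(4)])
  fix Y assume Y: "closedin X Y" "X interior_of Y = {}"
  show "compactin X Y"
  proof (rule compactin_if_omega1_subsets_in_compact[OF assms(2,5) Y(1)])
    fix S assume S: "S \<subseteq> Y" "|S| \<le>o cardSuc natLeq"
    have "|UNIV :: nat set| \<le>o cardSuc natLeq"
      using ordIso_ordLess_trans[OF card_of_nat cardSuc_greater[OF natLeq_Card_order]]
      by (rule ordLess_imp_ordLeq)
    then have "|S \<times> (UNIV :: nat set)| \<le>o cardSuc natLeq"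
      using S(2) countable_finite uncountable_omega1
      by (intro card_of_Times_ordLeq_infinite_Field cardSuc_Card_order natLeq_Card_order) auto
    then have "|S \<times> (UNIV :: nat set)| <o cov_meager"
      using assms(1) by (rule ordLeq_ordLess_trans)
    then show "\<exists>K. compactin X K \<and> S \<subseteq> K"
      using small_subset_of_nowhere_dense_in_compact[OF assms(2,3,5,4) Y S(1)] by blast
  qed
qed

end
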